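(* For every positive integer $n$, the multipacking number of the $n$-dimensional hypercube $Q_n$ satisfies $$\left\lfloor\frac{n}{2}\right\rfloor \leqslant \operatorname{mp}(Q_{n}) \leqslant \frac{n}{2} + 6\sqrt{2n}.$$
   Context: The $n$-dimensional hypercube $Q_n$ is the graph with vertex set $\{0,1\}^n$ in which two vertices are adjacent iff they differ in exactly one coordinate; $d(u,v)$ denotes graph distance. For a graph $G$, a vertex $v$ and an integer $k\geqslant 0$, $N_k[v]$ is the set of vertices at distance at most $k$ from $v$. A set $M\subseteq V(G)$ is a multipacking in $G$ if for every vertex $v\in V(G)$ and every integer $k\geqslant 1$, $|N_k[v]\cap M|\leqslant k$. The multipacking number $\operatorname{mp}(G)$ is the maximum cardinality of a multipacking in $G$. *)

theory Defs
  imports "Graph_Theory.Digraph" "Graph_Theory.Shortest_Path"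
begin

text \<open>
  An undirected graph is represented, as in the library locale \<^locale>\<open>graph\<close>, by a finite
  loop-free symmetric digraph without parallel arcs: each edge contributes one arc per direction.
\<close>

definition hypercube :: "nat \<Rightarrow> (bool list, bool list \<times> bool list) pre_digraph" where
  "hypercube n = \<lparr>
     verts = {u. length u = n},
     arcs = {(u, v). length u = n \<and> length v = n \<and> card {i. i < n \<and> u ! i \<noteq> v ! i} = 1},
     tail = fst,
     head = snd \<rparr>"

text \<open>Shortest-path cost with unit weights; it is infinite if there is no walk.\<close>

definition graph_dist :: "('a, 'b) pre_digraph \<Rightarrow> 'a \<Rightarrow> 'a \<Rightarrow> ereal" where
  "graph_dist G u v = wf_digraph.\<mu> G (\<lambda>_. 1) u v"

definition closed_nbhd :: "('a, 'b) pre_digraph \<Rightarrow> nat \<Rightarrow> 'a \<Rightarrow> 'a set" where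
  "closed_nbhd G k v = {u \<in> verts G. graph_dist G v u \<le> ereal (real k)}"

definition multipacking :: "('a, 'b) pre_digraph \<Rightarrow> 'a set \<Rightarrow> bool" where
  "multipacking G M \<longleftrightarrow>
     M \<subseteq> verts G \<and> (\<forall>v\<in>verts G. \<forall>k\<ge>1. card (closed_nbhd G k v \<inter> M) \<le> k)"

text \<open>Meaningful for graphs with finitely many vertices only (see the lemmas below).\<close>

definition mp :: "('a, 'b) pre_digraph \<Rightarrow> nat" where
  "mp G = Max {card M | M. multipacking G M}"

lemma finite_multipackings:
  assumes "finite (verts G)"
  shows "finite {card M | M. multipacking G M}"
proof -
  have "{card M | M. multipacking G M} \<subseteq> card ` Pow (verts G)"
    by (auto simp: multipacking_def)
  then show ?thesis
    using assms by (meson finite_Pow_iff finite_imageI finite_subset)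
qed

lemma multipacking_empty: "multipacking G {}"
  by (simp add: multipacking_def)

lemma graph_hypercube: "graph (hypercube n)"
proof -
  have fin: "finite {u :: bool list. length u = n}"
    using finite_lists_length_eq[of "UNIV :: bool set" n] by simp
  have sub: "arcs (hypercube n) \<subseteq> {u. length u = n} \<times> {u. length u = n}"
    by (auto simp: hypercube_def)
  have finarcs: "finite (arcs (hypercube n))"
    using sub fin by (meson finite_SigmaI finite_subset)
  have "(v, u) \<in> arcs (hypercube n)" if "(u, v) \<in> arcs (hypercube n)" for u v
  proof -
    have "{i. i < n \<and> v ! i \<noteq> u ! i} = {i. i < n \<and> u ! i \<noteq> v ! i}"
      by auto
    with that show ?thesis
      by (simp only: hypercube_def pre_digraph.simps mem_Collect_eq case_prod_conv)
  qed
  moreover have "arcs_ends (hypercube n) = arcs (hypercube n)"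
    by (simp add: arcs_ends_def arc_to_ends_def hypercube_def)
  ultimately have sym: "sym (arcs_ends (hypercube n))"
    unfolding sym_def by simp
  have "finite (verts (hypercube n))"
    using fin by (simp add: hypercube_def)
  moreover have "u \<noteq> v" if "(u, v) \<in> arcs (hypercube n)" for u v
    using that by (auto simp: hypercube_def)
  moreover have "tail (hypercube n) = fst" "head (hypercube n) = snd"
    by (simp_all add: hypercube_def)
  moreover have "wf_digraph (hypercube n)"
    by unfold_locales (auto simp: hypercube_def)
  ultimately show ?thesis
    using finarcs sym
    by unfold_locales
      (auto simp: wf_digraph_def symmetric_def arc_to_ends_def prod_eq_iff)
qed

end

theory Submission
  imports Defs "HOL-Analysis.Function_Topology" "HOL-Analysis.Convex"
begin

text \<open>
  Lower bound: on an isometric cycle of length \<open>2 * n\<close> take about \<open>n / 4\<close> antipodal pairs of points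
  that are at distance at least 3 from each other. A ball of radius \<open>k < n / 2\<close> contains at most one
  point of each pair, and for \<open>k < n / 4\<close> its points lie on an arc of length \<open>2 * k\<close>, so that
  there are at most \<open>2 * k / 3 + 1\<close> of them.

  Upper bound: a multipacking has at most \<open>n\<close> points, because a ball of radius \<open>n\<close> is everything.
  Regard them as sign vectors. By Spencer's theorem some sign vector has inner product at least
  \<open>- 12 * sqrt (2 * n)\<close> with all of them, so a ball of radius \<open>n / 2 + 6 * sqrt (2 * n)\<close>
  contains the whole multipacking.
\<close>

section \<open>Discrepancy of sign vectors\<close>

text \<open>Gaussian elimination: an equation with a nonzero coefficient at \<open>a\<close> is
  solved for that unknown, which leaves one equation and one unknown fewer.\<close>

lemma homogeneous_system_nontrivial_solution:
  fixes c :: "'k \<Rightarrow> 'j \<Rightarrow> 'a::field"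
  assumes "finite K" "finite A" "card K < card A"
  shows "\<exists>y. (\<forall>j. j \<notin> A \<longrightarrow> y j = 0) \<and> (\<exists>j\<in>A. y j \<noteq> 0) \<and> (\<forall>k\<in>K. (\<Sum>j\<in>A. c k j * y j) = 0)"
  using assms
proof (induction K arbitrary: A c rule: finite_induct)
  case empty
  then obtain a where "a \<in> A" by fastforce
  then show ?case
    by (intro exI[of _ "\<lambda>j. if j = a then 1 else 0"]) auto
next
  case (insert k K)
  show ?case
  proof (cases "\<forall>j\<in>A. c k j = 0")
    case True
    then have "(\<Sum>j\<in>A. c k j * y j) = 0" for y
      by simp
    moreover have "card K < card A"
      using insert by simp
    ultimately show ?thesis
      using insert.IH[of A c] insert.prems(1) by (metis insert_iff)
  next
    case False
    then obtain a where a: "a \<in> A" "c k a \<noteq> 0" by blast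
    \<comment> \<open>\<open>c'\<close> holds the coefficients after substituting for the unknown
      \<open>a\<close>; below, \<open>z\<close> restores the value at \<open>a\<close> that equation
      \<open>k\<close> forces.\<close>
    define c' where "c' l j = c l j - c l a * c k j / c k a" for l j
    have "card K < card (A - {a})"
      using insert a by simp
    from insert.IH[OF finite_Diff[OF insert.prems(1)] this, of c'] obtain y where
      y: "\<forall>j. j \<notin> A - {a} \<longrightarrow> y j = 0" "\<exists>j\<in>A - {a}. y j \<noteq> 0"
        "\<forall>l\<in>K. (\<Sum>j\<in>A - {a}. c' l j * y j) = 0"
      by blast
    define r where "r = (\<Sum>j\<in>A - {a}. c k j * y j)"
    define z where "z = y(a := - r / c k a)"
    have sum_z: "(\<Sum>j\<in>A. c l j * z j) = (\<Sum>j\<in>A - {a}. c l j * y j) - c l a * r / c k a" for l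
    proof -
      have "(\<Sum>j\<in>A. c l j * z j) = c l a * z a + (\<Sum>j\<in>A - {a}. c l j * z j)"
        using a insert.prems by (simp add: sum.remove)
      also have "(\<Sum>j\<in>A - {a}. c l j * z j) = (\<Sum>j\<in>A - {a}. c l j * y j)"
        by (intro sum.cong refl) (simp add: z_def)
      finally show ?thesis by (simp add: z_def)
    qed
    have "(\<Sum>j\<in>A. c k j * z j) = 0"
      using a by (simp add: sum_z r_def)
    moreover have "(\<Sum>j\<in>A. c l j * z j) = 0" if "l \<in> K" for l
    proof -
      have "(\<Sum>j\<in>A - {a}. c' l j * y j) = (\<Sum>j\<in>A - {a}. c l j * y j) - c l a * r / c k a"
        by (simp add: c'_def r_def left_diff_distrib sum_subtractf sum_distrib_left
            sum_divide_distrib mult.assoc)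
      then show ?thesis using y(3) that by (simp add: sum_z)
    qed
    moreover have "\<exists>j\<in>A. z j \<noteq> 0" "\<And>j. j \<notin> A \<Longrightarrow> z j = 0"
      using y(1,2) a by (auto simp: z_def)
    ultimately show ?thesis by blast
  qed
qed

text \<open>Vectors are added one by one: orthogonality to the rows in \<open>K\<close> and to the
  \<open>d\<close> earlier vectors amounts to fewer equations than unknowns, so a nonzero solution
  exists and can be normalised.\<close>

lemma orthonormal_system_in_orthogonal_complement:
  fixes c :: "'k \<Rightarrow> 'j \<Rightarrow> real"
  assumes "finite K" "finite A" "d + card K \<le> card A"
  shows "\<exists>e :: nat \<Rightarrow> 'j \<Rightarrow> real.
    (\<forall>l<d. \<forall>j. j \<notin> A \<longrightarrow> e l j = 0) \<and>
    (\<forall>l<d. \<forall>k\<in>K. (\<Sum>j\<in>A. c k j * e l j) = 0) \<and>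
    (\<forall>l<d. \<forall>l'<d. (\<Sum>j\<in>A. e l j * e l' j) = (if l = l' then 1 else 0))"
  using assms(3)
proof (induction d)
  case 0
  then show ?case by simp
next
  case (Suc d)
  from Suc.prems have "d + card K \<le> card A" by simp
  from Suc.IH[OF this] obtain e :: "nat \<Rightarrow> 'j \<Rightarrow> real" where
    e: "\<forall>l<d. \<forall>j. j \<notin> A \<longrightarrow> e l j = 0"
      "\<forall>l<d. \<forall>k\<in>K. (\<Sum>j\<in>A. c k j * e l j) = 0"
      "\<forall>l<d. \<forall>l'<d. (\<Sum>j\<in>A. e l j * e l' j) = (if l = l' then 1 else 0)"
    by blast
  have "card (K <+> {..<d}) < card A"
    using Suc.prems assms by (simp add: card_Plus)
  then obtain y where y: "\<And>j. j \<notin> A \<Longrightarrow> y j = 0" "\<exists>j\<in>A. y j \<noteq> 0"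
      "\<And>k. k \<in> K <+> {..<d} \<Longrightarrow> (\<Sum>j\<in>A. case_sum c e k j * y j) = 0"
    using homogeneous_system_nontrivial_solution[of "K <+> {..<d}" A "case_sum c e"] assms
    by (metis finite_Plus finite_lessThan)
  define s where "s = (\<Sum>j\<in>A. y j ^ 2)"
  have "s > 0"
    using y(2) assms unfolding s_def by (auto intro: sum_pos2)
  define z where "z j = y j / sqrt s" for j
  have z0: "z j = 0" if "j \<notin> A" for j
    using y(1) that by (simp add: z_def)
  have sz: "(\<Sum>j\<in>A. f j * z j) = (\<Sum>j\<in>A. f j * y j) / sqrt s" for f
    by (simp add: z_def sum_divide_distrib)
  have zz: "(\<Sum>j\<in>A. z j * z j) = 1"
    using \<open>s > 0\<close> by (simp add: z_def s_def power2_eq_square flip: sum_divide_distrib)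
  have zK: "(\<Sum>j\<in>A. c k j * z j) = 0" if "k \<in> K" for k
    using y(3)[OF InlI] that by (simp add: sz)
  have ze: "(\<Sum>j\<in>A. e l j * z j) = 0" if "l < d" for l
    using y(3)[OF InrI] that by (simp add: sz)
  have ez: "(\<Sum>j\<in>A. z j * e l j) = 0" if "l < d" for l
    using ze[OF that] by (simp add: mult.commute)
  show ?case
    by (rule exI[of _ "e(d := z)"]) (auto simp: less_Suc_eq e z0 zz zK ze ez)
qed

text \<open>In the proof, \<open>w\<close> is the orthogonal projection of \<open>u\<close> onto the
  span of the system. Its inner products with \<open>u\<close> and with itself both equal the
  left-hand side, so expanding the squared length of \<open>u - w\<close> gives the claim.\<close>

lemma Bessel_inequality_sum:
  fixes e :: "nat \<Rightarrow> 'j \<Rightarrow> real"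
  assumes e: "\<And>l l'. l < d \<Longrightarrow> l' < d \<Longrightarrow> (\<Sum>j\<in>A. e l j * e l' j) = (if l = l' then 1 else 0)"
  shows "(\<Sum>l<d. (\<Sum>j\<in>A. u j * e l j)\<^sup>2) \<le> (\<Sum>j\<in>A. (u j)\<^sup>2)"
proof -
  define p where "p l = (\<Sum>j\<in>A. u j * e l j)" for l
  define w where "w j = (\<Sum>l<d. p l * e l j)" for j
  have uw: "(\<Sum>j\<in>A. u j * w j) = (\<Sum>l<d. (p l)\<^sup>2)"
  proof -
    have "(\<Sum>j\<in>A. u j * w j) = (\<Sum>j\<in>A. \<Sum>l<d. p l * (u j * e l j))"
      by (simp add: w_def sum_distrib_left mult_ac)
    also have "\<dots> = (\<Sum>l<d. \<Sum>j\<in>A. p l * (u j * e l j))"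
      by (rule sum.swap)
    finally show ?thesis
      by (simp add: p_def power2_eq_square flip: sum_distrib_left)
  qed
  have "(\<Sum>j\<in>A. w j * e l j) = p l" if "l < d" for l
  proof -
    have "(\<Sum>j\<in>A. w j * e l j) = (\<Sum>j\<in>A. \<Sum>l'<d. p l' * (e l' j * e l j))"
      by (simp add: w_def sum_distrib_right sum_distrib_left mult_ac)
    also have "\<dots> = (\<Sum>l'<d. \<Sum>j\<in>A. p l' * (e l' j * e l j))"
      by (rule sum.swap)
    also have "\<dots> = (\<Sum>l'<d. p l' * (if l' = l then 1 else 0))"
      using that by (simp add: e flip: sum_distrib_left)
    finally show ?thesis using that by (simp add: if_distrib cong: if_cong)
  qed
  moreover have "(\<Sum>j\<in>A. w j * w j) = (\<Sum>l<d. p l * (\<Sum>j\<in>A. w j * e l j))"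
  proof -
    have "(\<Sum>j\<in>A. w j * w j) = (\<Sum>j\<in>A. \<Sum>l<d. p l * (w j * e l j))"
      by (subst (2) w_def) (simp add: sum_distrib_left mult_ac)
    also have "\<dots> = (\<Sum>l<d. \<Sum>j\<in>A. p l * (w j * e l j))"
      by (rule sum.swap)
    finally show ?thesis by (simp add: sum_distrib_left)
  qed
  ultimately have ww: "(\<Sum>j\<in>A. (w j)\<^sup>2) = (\<Sum>l<d. (p l)\<^sup>2)"
    by (simp add: power2_eq_square)
  have "0 \<le> (\<Sum>j\<in>A. (u j - w j)\<^sup>2)"
    by (simp add: sum_nonneg)
  also have "\<dots> = (\<Sum>j\<in>A. (u j)\<^sup>2) - 2 * (\<Sum>j\<in>A. u j * w j) + (\<Sum>j\<in>A. (w j)\<^sup>2)"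
    by (simp add: power2_diff sum.distrib sum_subtractf sum_distrib_left algebra_simps)
  finally show ?thesis by (simp add: uw ww flip: p_def)
qed

section \<open>Spencer's theorem by partial colouring\<close>

text \<open>The odd powers of \<open>t\<close> cancel. Splitting off \<open>2 * t\<^sup>2\<close>
  leaves a bracket that tends to the second-order term as \<open>t\<close> tends to 0.\<close>

lemma sum_fourth_powers_symmetric_difference:
  fixes s q :: "'i \<Rightarrow> real"
  shows "(\<Sum>i\<in>S. (s i + t * q i) ^ 4) + (\<Sum>i\<in>S. (s i - t * q i) ^ 4) =
    2 * (\<Sum>i\<in>S. s i ^ 4) + 2 * t\<^sup>2 * ((\<Sum>i\<in>S. 6 * (s i)\<^sup>2 * (q i)\<^sup>2) + t\<^sup>2 * (\<Sum>i\<in>S. q i ^ 4))"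
proof -
  have "(a + t * b) ^ 4 + (a - t * b) ^ 4 = 2 * a ^ 4 + 2 * t\<^sup>2 * (6 * a\<^sup>2 * b\<^sup>2 + t\<^sup>2 * b ^ 4)" for a b :: real
    by algebra
  then have "(\<Sum>i\<in>S. (s i + t * q i) ^ 4 + (s i - t * q i) ^ 4) =
      (\<Sum>i\<in>S. 2 * s i ^ 4 + 2 * t\<^sup>2 * (6 * (s i)\<^sup>2 * (q i)\<^sup>2 + t\<^sup>2 * q i ^ 4))"
    by simp
  then show ?thesis
    by (simp add: sum.distrib distrib_left sum_distrib_left mult_ac)
qed

text \<open>One round of Spencer's argument. \<open>N\<close> is separate from \<open>card A\<close>
  because the rows stay the same from round to round while fewer and fewer coordinates remain
  fractional.\<close>

lemma partial_colouring:
  fixes c :: "'i \<Rightarrow> 'j \<Rightarrow> real" and x :: "'j \<Rightarrow> real" and N :: real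
  assumes fin: "finite S" "finite A" and "A \<noteq> {}" and N: "N > 0" "card S \<le> N"
    and c: "\<And>i j. i \<in> S \<Longrightarrow> j \<in> A \<Longrightarrow> \<bar>c i j\<bar> \<le> 1"
    and x: "\<And>j. j \<in> A \<Longrightarrow> \<bar>x j\<bar> \<le> 1"
  shows "\<exists>z. (\<forall>j. j \<notin> A \<longrightarrow> z j = x j) \<and> (\<forall>j\<in>A. \<bar>z j\<bar> \<le> 1) \<and>
    16 * card {j \<in> A. \<bar>z j\<bar> < 1} \<le> card A \<and>
    (\<forall>i\<in>S. \<bar>\<Sum>j\<in>A. c i j * (z j - x j)\<bar> \<le> 6 * sqrt 2 * sqrt (sqrt (N * card A)))"
proof -
  define a :: real where "a = card A"
  have a: "a > 0" using fin \<open>A \<noteq> {}\<close> by (simp add: a_def card_gt_0_iff)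
  txt \<open>
    Minimise the sum of the fourth powers of the discrepancies \<open>P i\<close>, minus \<open>lam\<close> times the
    squared length, over the cube cut by the slabs \<open>\<bar>P i\<bar> \<le> L\<close>. If too many coordinates of the
    minimiser were fractional, then, since few slabs are tight, the second-order condition along
    an orthonormal system of feasible directions would contradict Bessel's inequality.
    The constants \<open>lam\<close> and \<open>L\<close> leave at most \<open>a / 48\<close> slabs tight.
  \<close>
  define lam where "lam = 108 * N * a"
  define L where "L = 6 * sqrt 2 * sqrt (sqrt (N * a))"
  have L: "L > 0" using N a by (simp add: L_def)
  have L4: "L ^ 4 = 5184 * N * a"
  proof -
    have fourth: "r ^ 4 = (r\<^sup>2)\<^sup>2" for r :: real
      by simp
    have "sqrt 2 ^ 4 = 4" "sqrt (sqrt (N * a)) ^ 4 = N * a"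
      unfolding fourth using N a by simp_all
    then show ?thesis by (simp add: L_def power_mult_distrib)
  qed
  have lam: "lam > 0" using N a by (simp add: lam_def)
  define P where "P i z = (\<Sum>j\<in>A. c i j * (z j - x j))" for i and z :: "'j \<Rightarrow> real"
  \<comment> \<open>Pinning the coordinates outside \<open>A\<close> to singletons makes every
    factor compact, so that Tychonoff's theorem applies over the whole index type.\<close>
  define B where "B j = (if j \<in> A then {-1..1} else {x j})" for j
  define K where "K = PiE UNIV B \<inter> {z. \<forall>i\<in>S. \<bar>P i z\<bar> \<le> L}"
  have K_iff: "z \<in> K \<longleftrightarrow> (\<forall>j\<in>A. \<bar>z j\<bar> \<le> 1) \<and> (\<forall>j. j \<notin> A \<longrightarrow> z j = x j) \<and> (\<forall>i\<in>S. \<bar>P i z\<bar> \<le> L)" for z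
    by (auto simp: K_def B_def PiE_iff abs_le_iff split: if_splits)
  define F where "F z = (\<Sum>i\<in>S. P i z ^ 4) - lam * (\<Sum>j\<in>A. (z j)\<^sup>2)" for z
  have coord: "continuous_on X (\<lambda>z. z j)" for X :: "('j \<Rightarrow> real) set" and j
    by (rule continuous_on_subset[OF continuous_on_product_coordinates subset_UNIV])
  have contP: "continuous_on X (P i)" for X i
    unfolding P_def[abs_def] by (intro continuous_intros coord)
  have contF: "continuous_on K F"
    unfolding F_def[abs_def] by (intro continuous_intros coord contP)
  have "compactin (product_topology (\<lambda>i. euclidean) UNIV) (PiE UNIV B)"
    unfolding compactin_PiE by (auto simp: B_def)
  then have compB: "compact (PiE UNIV B)"
    by (simp add: euclidean_product_topology)
  have "closed {z. \<bar>P i z\<bar> \<le> L}" for i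
    by (intro closed_Collect_le continuous_intros contP)
  then have "closed (\<Inter>i\<in>S. {z. \<bar>P i z\<bar> \<le> L})"
    by blast
  also have "(\<Inter>i\<in>S. {z. \<bar>P i z\<bar> \<le> L}) = {z. \<forall>i\<in>S. \<bar>P i z\<bar> \<le> L}"
    by blast
  finally have compK: "compact K"
    unfolding K_def using compB by (rule compact_Int_closed[rotated])
  have xK: "x \<in> K"
    using x L by (simp add: K_iff P_def)
  then obtain z where z: "z \<in> K" and zmin: "\<And>w. w \<in> K \<Longrightarrow> F z \<le> F w"
    using continuous_attains_inf[OF compK _ contF] by blast
  define s where "s i = P i z" for i
  \<comment> \<open>All discrepancies vanish at \<open>x\<close>, so comparing the minimiser with
    \<open>x\<close> bounds its fourth powers by \<open>lam * a\<close>.\<close>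
  have "F z \<le> F x" by (rule zmin[OF xK])
  also have "F x = - (lam * (\<Sum>j\<in>A. (x j)\<^sup>2))"
    by (simp add: F_def P_def)
  also have "\<dots> \<le> 0"
    using lam by (simp add: sum_nonneg)
  finally have "(\<Sum>i\<in>S. s i ^ 4) \<le> lam * (\<Sum>j\<in>A. (z j)\<^sup>2)"
    by (simp add: F_def s_def)
  also have "(\<Sum>j\<in>A. (z j)\<^sup>2) \<le> (\<Sum>j\<in>A. 1)"
    using z by (intro sum_mono) (simp add: K_iff abs_square_le_1)
  finally have s4: "(\<Sum>i\<in>S. s i ^ 4) \<le> lam * a"
    using lam by (simp add: a_def)
  define A' where "A' = {j \<in> A. \<bar>z j\<bar> < 1}"
  define I where "I = {i \<in> S. \<bar>s i\<bar> = L}"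
  have finA': "finite A'" and finI: "finite I"
    using fin by (simp_all add: A'_def I_def)
  \<comment> \<open>Such a \<open>y\<close> moves only fractional coordinates and keeps the tight
    slabs tight, so \<open>z + t * y\<close> and \<open>z - t * y\<close> are feasible for small
    \<open>t\<close>. Adding the values of \<open>F\<close> at both cancels the linear terms; a
    violated inequality would put one of them below the minimum.\<close>
  have second_order: "lam * (\<Sum>j\<in>A'. (y j)\<^sup>2) \<le> (\<Sum>i\<in>S. 6 * (s i)\<^sup>2 * (\<Sum>j\<in>A'. c i j * y j)\<^sup>2)"
    if y: "\<And>j. j \<notin> A' \<Longrightarrow> y j = 0" "\<And>i. i \<in> I \<Longrightarrow> (\<Sum>j\<in>A'. c i j * y j) = 0" for y
  proof (rule ccontr)
    define q where "q i = (\<Sum>j\<in>A'. c i j * y j)" for i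
    define Y where "Y = (\<Sum>j\<in>A'. (y j)\<^sup>2)"
    assume "\<not> ?thesis"
    then have less: "(\<Sum>i\<in>S. 6 * (s i)\<^sup>2 * (q i)\<^sup>2) < lam * Y"
      by (simp add: q_def Y_def)
    have q: "(\<Sum>j\<in>A. c i j * y j) = q i" for i
      unfolding q_def by (rule sum.mono_neutral_right) (use fin y in \<open>auto simp: A'_def\<close>)
    have Y: "(\<Sum>j\<in>A. (y j)\<^sup>2) = Y"
      unfolding Y_def by (rule sum.mono_neutral_right) (use fin y in \<open>auto simp: A'_def\<close>)
    have P_move: "P i (\<lambda>j. z j + t * y j) = s i + t * q i" for i t
      by (simp add: P_def s_def sum.distrib sum_subtractf sum_distrib_left algebra_simps flip: q)
    have sq_move: "(\<Sum>j\<in>A. (z j + t * y j)\<^sup>2) = (\<Sum>j\<in>A. (z j)\<^sup>2) + 2 * t * (\<Sum>j\<in>A. z j * y j) + t\<^sup>2 * Y" for t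
      by (simp add: power2_sum power_mult_distrib sum.distrib sum_distrib_left algebra_simps flip: Y)
    have feasible: "\<forall>\<^sub>F t in at 0. (\<lambda>j. z j + t * y j) \<in> K"
    proof -
      have "\<forall>\<^sub>F t in at 0. \<bar>z j + t * y j\<bar> \<le> 1" if "j \<in> A" for j
      proof (cases "j \<in> A'")
        case True
        have "((\<lambda>t. \<bar>z j + t * y j\<bar>) \<longlongrightarrow> \<bar>z j + 0 * y j\<bar>) (at 0)"
          by (intro tendsto_intros)
        then have "\<forall>\<^sub>F t in at 0. \<bar>z j + t * y j\<bar> < 1"
          by (rule order_tendstoD) (use True in \<open>simp add: A'_def\<close>)
        then show ?thesis by eventually_elim simp
      next
        case False
        then show ?thesis using y(1) z that by (simp add: K_iff)
      qed
      then have 1: "\<forall>\<^sub>F t in at 0. \<forall>j\<in>A. \<bar>z j + t * y j\<bar> \<le> 1"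
        using fin by (simp add: eventually_ball_finite)
      have "\<forall>\<^sub>F t in at 0. \<bar>s i + t * q i\<bar> \<le> L" if "i \<in> S" for i
      proof (cases "i \<in> I")
        case True
        then show ?thesis using y(2) by (simp add: I_def q_def)
      next
        case False
        have "((\<lambda>t. \<bar>s i + t * q i\<bar>) \<longlongrightarrow> \<bar>s i + 0 * q i\<bar>) (at 0)"
          by (intro tendsto_intros)
        moreover have "\<bar>s i\<bar> < L"
          using False z that by (auto simp: I_def K_iff s_def less_le)
        ultimately have "\<forall>\<^sub>F t in at 0. \<bar>s i + t * q i\<bar> < L"
          by (intro order_tendstoD) simp_all
        then show ?thesis by eventually_elim simp
      qed
      then have 2: "\<forall>\<^sub>F t in at 0. \<forall>i\<in>S. \<bar>s i + t * q i\<bar> \<le> L"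
        using fin by (simp add: eventually_ball_finite)
      have 3: "z j + t * y j = x j" if "j \<notin> A" for j t
        using that z y(1) by (simp add: K_iff A'_def)
      show ?thesis
        using 1 2 by eventually_elim (simp add: K_iff P_move 3)
    qed
    \<comment> \<open>Feasibility is carried over to \<open>- t\<close>, since one \<open>t\<close>
      has to serve for both signs.\<close>
    have "filterlim uminus (at (0::real)) (at 0)"
      by (auto simp: filterlim_at eventually_at_filter intro!: tendsto_eq_intros)
    with feasible have "\<forall>\<^sub>F t in at 0. (\<lambda>j. z j + (- t) * y j) \<in> K"
      by (rule eventually_compose_filterlim)
    moreover have "((\<lambda>t. (\<Sum>i\<in>S. 6 * (s i)\<^sup>2 * (q i)\<^sup>2) + t\<^sup>2 * (\<Sum>i\<in>S. q i ^ 4)) \<longlongrightarrow>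
        (\<Sum>i\<in>S. 6 * (s i)\<^sup>2 * (q i)\<^sup>2) + 0\<^sup>2 * (\<Sum>i\<in>S. q i ^ 4)) (at 0)"
      by (intro tendsto_intros)
    then have "\<forall>\<^sub>F t in at 0. (\<Sum>i\<in>S. 6 * (s i)\<^sup>2 * (q i)\<^sup>2) + t\<^sup>2 * (\<Sum>i\<in>S. q i ^ 4) < lam * Y"
      by (rule order_tendstoD) (use less in simp)
    moreover have "\<forall>\<^sub>F t in at (0::real). t \<noteq> 0"
      by (simp add: eventually_at_filter)
    ultimately have "\<forall>\<^sub>F t in at 0. (\<lambda>j. z j + t * y j) \<in> K \<and> (\<lambda>j. z j + (- t) * y j) \<in> K \<and> t \<noteq> 0 \<and>
        (\<Sum>i\<in>S. 6 * (s i)\<^sup>2 * (q i)\<^sup>2) + t\<^sup>2 * (\<Sum>i\<in>S. q i ^ 4) < lam * Y"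
      using feasible by eventually_elim simp
    then obtain t where t: "(\<lambda>j. z j + t * y j) \<in> K" "(\<lambda>j. z j + (- t) * y j) \<in> K" "t \<noteq> 0"
        "(\<Sum>i\<in>S. 6 * (s i)\<^sup>2 * (q i)\<^sup>2) + t\<^sup>2 * (\<Sum>i\<in>S. q i ^ 4) < lam * Y"
      using eventually_happens'[OF trivial_limit_at[of "0::real"]] by blast
    have "F (\<lambda>j. z j + t * y j) + F (\<lambda>j. z j + (- t) * y j) = 2 * F z + 2 * t\<^sup>2 *
        ((\<Sum>i\<in>S. 6 * (s i)\<^sup>2 * (q i)\<^sup>2) + t\<^sup>2 * (\<Sum>i\<in>S. q i ^ 4) - lam * Y)"
      using sum_fourth_powers_symmetric_difference[of s t q S]
      unfolding F_def P_move sq_move s_def[symmetric] by (simp add: algebra_simps)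
    moreover have "2 * t\<^sup>2 * ((\<Sum>i\<in>S. 6 * (s i)\<^sup>2 * (q i)\<^sup>2) + t\<^sup>2 * (\<Sum>i\<in>S. q i ^ 4) - lam * Y) < 0"
      using t(3,4) by (intro mult_pos_neg) simp_all
    ultimately show False
      using zmin[OF t(1)] zmin[OF t(2)] by linarith
  qed
  have "16 * card A' \<le> card A"
  proof (rule ccontr)
    assume "\<not> 16 * card A' \<le> card A"
    then have a': "a < 16 * card A'" by (simp add: a_def)
    define X where "X = (\<Sum>i\<in>S. (s i)\<^sup>2)"
    have "X\<^sup>2 \<le> (\<Sum>i\<in>S. ((s i)\<^sup>2)\<^sup>2) * card S"
      unfolding X_def by (rule sum_squared_le_sum_of_squares)
    also have "\<dots> \<le> lam * a * N"
      using s4 N lam a by (intro mult_mono) (simp_all flip: power_mult)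
    also have "\<dots> = 108 * (N * a)\<^sup>2"
      by (simp add: lam_def power2_eq_square)
    \<comment> \<open>\<open>441 / 4\<close> is the square of \<open>21 / 2\<close>, a rational
      number just above the root of 108.\<close>
    also have "\<dots> \<le> 441 / 4 * (N * a)\<^sup>2"
      by (intro mult_right_mono) simp_all
    also have "\<dots> = (21 / 2 * (N * a))\<^sup>2"
      by (simp add: power_mult_distrib power2_eq_square)
    finally have X: "X \<le> 21 / 2 * (N * a)"
      by (rule power2_le_imp_le) (use N a in simp)
    have "s i ^ 4 = L ^ 4" if "i \<in> I" for i
    proof -
      have "L = \<bar>s i\<bar>" using that by (simp add: I_def)
      then show ?thesis by simp
    qed
    \<comment> \<open>Each tight slab contributes \<open>L ^ 4\<close>, that is
      \<open>48 * lam\<close>, to a sum of at most \<open>lam * a\<close>.\<close>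
    then have "card I * L ^ 4 = (\<Sum>i\<in>I. s i ^ 4)"
      by simp
    also have "\<dots> \<le> (\<Sum>i\<in>S. s i ^ 4)"
      by (rule sum_mono2) (use fin in \<open>auto simp: I_def\<close>)
    also note s4
    finally have "(108 * N * a) * (48 * card I) \<le> (108 * N * a) * a"
      by (simp add: L4 lam_def)
    then have I: "48 * card I \<le> a"
      using N a by (subst (asm) mult_le_cancel_left_pos) simp_all
    \<comment> \<open>As \<open>a < 16 * card A'\<close>, the tight slabs cost less than a third of
      the \<open>card A'\<close> dimensions.\<close>
    define d where "d = card A' - card I"
    have d: "3 * d > 2 * real (card A')" and le: "d + card I \<le> card A'"
      using I a' by (auto simp: d_def of_nat_diff)
    obtain e :: "nat \<Rightarrow> 'j \<Rightarrow> real" where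
      e: "\<forall>l<d. \<forall>j. j \<notin> A' \<longrightarrow> e l j = 0" "\<forall>l<d. \<forall>i\<in>I. (\<Sum>j\<in>A'. c i j * e l j) = 0"
        "\<forall>l<d. \<forall>l'<d. (\<Sum>j\<in>A'. e l j * e l' j) = (if l = l' then 1 else 0)"
      using orthonormal_system_in_orthogonal_complement[OF finI finA' le, of c] by blast
    \<comment> \<open>The second-order condition is summed over all \<open>d\<close> directions, so
      that Bessel's inequality applies to each row.\<close>
    have "lam * d = (\<Sum>l<d. lam * (\<Sum>j\<in>A'. (e l j)\<^sup>2))"
      using e(3) by (simp add: power2_eq_square)
    also have "\<dots> \<le> (\<Sum>l<d. \<Sum>i\<in>S. 6 * (s i)\<^sup>2 * (\<Sum>j\<in>A'. c i j * e l j)\<^sup>2)"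
      using e by (intro sum_mono second_order) auto
    also have "\<dots> = (\<Sum>i\<in>S. 6 * (s i)\<^sup>2 * (\<Sum>l<d. (\<Sum>j\<in>A'. c i j * e l j)\<^sup>2))"
      by (subst sum.swap) (simp add: sum_distrib_left)
    also have "\<dots> \<le> (\<Sum>i\<in>S. 6 * (s i)\<^sup>2 * card A')"
    proof (intro sum_mono mult_left_mono)
      fix i assume "i \<in> S"
      have "(\<Sum>l<d. (\<Sum>j\<in>A'. c i j * e l j)\<^sup>2) \<le> (\<Sum>j\<in>A'. (c i j)\<^sup>2)"
        using e(3) by (intro Bessel_inequality_sum) simp
      also have "\<dots> \<le> (\<Sum>j\<in>A'. 1)"
        using c[OF \<open>i \<in> S\<close>] by (intro sum_mono) (simp add: A'_def abs_square_le_1)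
      finally show "(\<Sum>l<d. (\<Sum>j\<in>A'. c i j * e l j)\<^sup>2) \<le> card A'"
        by simp
    qed simp
    also have "\<dots> = 6 * card A' * X"
      by (simp add: X_def sum_distrib_left mult_ac)
    also have "\<dots> \<le> 6 * card A' * (21 / 2 * (N * a))"
      using X by (intro mult_left_mono) simp_all
    finally have "(N * a) * (108 * d) \<le> (N * a) * (63 * card A')"
      by (simp add: lam_def algebra_simps)
    then have "108 * real d \<le> 63 * card A'"
      using N a by (subst (asm) mult_le_cancel_left_pos) simp_all
    then show False using d by linarith
  qed
  then show ?thesis
    using z unfolding K_iff A'_def P_def L_def a_def by blast
qed

text \<open>
  Iterating \<open>partial_colouring\<close> divides the number of fractional coordinates by 16 and hence the
  discrepancy of each round, its fourth root, by 2, so that the total is twice that of the first round.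
\<close>

theorem spencer_discrepancy:
  fixes c :: "'i \<Rightarrow> 'j \<Rightarrow> real"
  assumes "finite S" "finite J" "card S \<le> card J"
    and c: "\<And>i j. i \<in> S \<Longrightarrow> j \<in> J \<Longrightarrow> \<bar>c i j\<bar> \<le> 1"
  shows "\<exists>x. (\<forall>j\<in>J. \<bar>x j\<bar> = 1) \<and> (\<forall>i\<in>S. \<bar>\<Sum>j\<in>J. c i j * x j\<bar> \<le> 12 * sqrt 2 * sqrt (card J))"
proof (cases "J = {}")
  case True
  then show ?thesis by simp
next
  case False
  define N :: real where "N = card J"
  have N: "N > 0" "card S \<le> N"
    using assms False by (simp_all add: N_def card_gt_0_iff)
  \<comment> \<open>The starting point is arbitrary, so that the induction can restart from the
    outcome of a round.\<close>
  have "\<exists>z. (\<forall>j\<in>J. \<bar>z j\<bar> = 1) \<and>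
      (\<forall>i\<in>S. \<bar>\<Sum>j\<in>J. c i j * (z j - x j)\<bar> \<le> 12 * sqrt 2 * sqrt (sqrt (N * card {j \<in> J. \<bar>x j\<bar> < 1})))"
    if "\<forall>j\<in>J. \<bar>x j\<bar> \<le> 1" for x
    using that
  proof (induction "card {j \<in> J. \<bar>x j\<bar> < 1}" arbitrary: x rule: less_induct)
    case less
    define A where "A = {j \<in> J. \<bar>x j\<bar> < 1}"
    have A: "finite A" "A \<subseteq> J" using assms by (auto simp: A_def)
    show ?case
    proof (cases "A = {}")
      case True
      then have "\<forall>j\<in>J. \<bar>x j\<bar> = 1"
        using less.prems by (fastforce simp: A_def)
      then show ?thesis using N by (intro exI[of _ x]) simp
    next
      case False
      define D where "D = sqrt (sqrt (N * card A))"
      obtain y where y: "\<And>j. j \<notin> A \<Longrightarrow> y j = x j" "\<And>j. j \<in> A \<Longrightarrow> \<bar>y j\<bar> \<le> 1"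
          "16 * card {j \<in> A. \<bar>y j\<bar> < 1} \<le> card A"
          "\<And>i. i \<in> S \<Longrightarrow> \<bar>\<Sum>j\<in>A. c i j * (y j - x j)\<bar> \<le> 6 * sqrt 2 * D"
        using partial_colouring[OF \<open>finite S\<close> \<open>finite A\<close> False N, of c x] c less.prems A
        unfolding D_def by blast
      \<comment> \<open>Coordinates of \<open>J\<close> outside \<open>A\<close> keep their values,
        which have modulus 1 already.\<close>
      have "j \<in> A" if "j \<in> J" "\<bar>y j\<bar> < 1" for j
        using y(1)[of j] that by (cases "j \<in> A") (auto simp: A_def)
      then have alive: "{j \<in> J. \<bar>y j\<bar> < 1} = {j \<in> A. \<bar>y j\<bar> < 1}"
        using A by blast
      have "card A > 0"
        using A False by (simp add: card_gt_0_iff)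
      then have "card {j \<in> J. \<bar>y j\<bar> < 1} < card A"
        using y(3) unfolding alive by linarith
      moreover have "\<forall>j\<in>J. \<bar>y j\<bar> \<le> 1"
        using y(1,2) less.prems by metis
      ultimately obtain z where z: "\<forall>j\<in>J. \<bar>z j\<bar> = 1"
          "\<And>i. i \<in> S \<Longrightarrow> \<bar>\<Sum>j\<in>J. c i j * (z j - y j)\<bar> \<le>
            12 * sqrt 2 * sqrt (sqrt (N * card {j \<in> J. \<bar>y j\<bar> < 1}))"
        using less.hyps[of y] unfolding A_def by blast
      have "sqrt (sqrt (N * card {j \<in> J. \<bar>y j\<bar> < 1})) \<le> sqrt (sqrt (N * card A / 16))"
        using y(3) N unfolding alive by (simp add: real_sqrt_le_iff)
      also have "\<dots> = D / 2"
        by (simp add: D_def real_sqrt_divide)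
      finally have half: "sqrt (sqrt (N * card {j \<in> J. \<bar>y j\<bar> < 1})) \<le> D / 2" .
      have "\<bar>\<Sum>j\<in>J. c i j * (z j - x j)\<bar> \<le> 12 * sqrt 2 * D" if "i \<in> S" for i
      proof -
        have "(\<Sum>j\<in>J. c i j * (z j - x j)) = (\<Sum>j\<in>J. c i j * (z j - y j)) + (\<Sum>j\<in>J. c i j * (y j - x j))"
          by (simp add: right_diff_distrib flip: sum.distrib)
        also have "(\<Sum>j\<in>J. c i j * (y j - x j)) = (\<Sum>j\<in>A. c i j * (y j - x j))"
          by (rule sum.mono_neutral_right) (use assms A y(1) in auto)
        finally have "\<bar>\<Sum>j\<in>J. c i j * (z j - x j)\<bar> \<le>
            12 * sqrt 2 * sqrt (sqrt (N * card {j \<in> J. \<bar>y j\<bar> < 1})) + 6 * sqrt 2 * D"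
          using z(2)[OF that] y(4)[OF that] by linarith
        also have "\<dots> \<le> 12 * sqrt 2 * (D / 2) + 6 * sqrt 2 * D"
          using half by (intro add_right_mono mult_left_mono) simp_all
        finally show ?thesis by (simp add: mult_ac)
      qed
      then show ?thesis using z(1) unfolding D_def A_def by blast
    qed
  qed
  \<comment> \<open>At the zero vector every coordinate is fractional, and
    \<open>sqrt (sqrt (N * N))\<close> is \<open>sqrt N\<close>.\<close>
  from this[of "\<lambda>_. 0"] show ?thesis
    by (simp add: N_def)
qed

section \<open>Distances and balls in the hypercube\<close>

definition hamming :: "'a list \<Rightarrow> 'a list \<Rightarrow> nat" where
  "hamming u v = card {i. i < length u \<and> u ! i \<noteq> v ! i}"

lemma hamming_commute: "length u = length v \<Longrightarrow> hamming u v = hamming v u"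
  unfolding hamming_def by (rule arg_cong[where f = card]) auto

lemma hamming_triangle:
  assumes "length u = length v"
  shows "hamming u w \<le> hamming u v + hamming v w"
proof -
  have "hamming u w \<le> card ({i. i < length u \<and> u ! i \<noteq> v ! i} \<union> {i. i < length v \<and> v ! i \<noteq> w ! i})"
    unfolding hamming_def using assms by (intro card_mono) auto
  also have "\<dots> \<le> hamming u v + hamming v w"
    unfolding hamming_def by (rule card_Un_le)
  finally show ?thesis .
qed

lemma hamming_le_length: "hamming u v \<le> length u"
  using card_mono[of "{..<length u}" "{i. i < length u \<and> u ! i \<noteq> v ! i}"]
  by (auto simp: hamming_def)

lemma hamming_eq_0_iff: "length u = length v \<Longrightarrow> hamming u v = 0 \<longleftrightarrow> u = v"
  by (auto simp: hamming_def list_eq_iff_nth_eq)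

lemma hypercube_simps [simp]:
  "verts (hypercube n) = {u. length u = n}" "tail (hypercube n) = fst" "head (hypercube n) = snd"
  by (simp_all add: hypercube_def)

lemma arcs_hypercube_iff:
  "e \<in> arcs (hypercube n) \<longleftrightarrow>
    length (fst e) = n \<and> length (snd e) = n \<and> hamming (fst e) (snd e) = 1"
  by (cases e) (auto simp: hypercube_def hamming_def)

text \<open>Each arc changes one coordinate, so by the triangle inequality it lowers the distance to
  \<open>v\<close> by at most 1.\<close>

lemma awalk_hypercube_ge_hamming:
  assumes "pre_digraph.awalk (hypercube n) u p v"
  shows "hamming u v \<le> length p"
  using assms
proof (induction p arbitrary: u)
  interpret graph "hypercube n" by (rule graph_hypercube)
  {
    case Nil
    then show ?case by (simp add: awalk_Nil_iff hamming_eq_0_iff)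
  next
    case (Cons e p)
    then have e: "fst e = u" "e \<in> arcs (hypercube n)" and p: "awalk (snd e) p v"
      by (auto simp: awalk_Cons_iff)
    have "hamming u v \<le> hamming u (snd e) + hamming (snd e) v"
      using e by (intro hamming_triangle) (auto simp: arcs_hypercube_iff)
    also have "hamming u (snd e) = 1"
      using e by (simp add: arcs_hypercube_iff)
    finally show ?case
      using Cons.IH[OF p] by simp
  }
qed

text \<open>A shortest walk corrects one differing coordinate per arc.\<close>

lemma ex_awalk_hypercube_hamming:
  assumes "length u = n" "length v = n"
  shows "\<exists>p. pre_digraph.awalk (hypercube n) u p v \<and> length p = hamming u v"
  using assms(1)
proof (induction "hamming u v" arbitrary: u)
  interpret graph "hypercube n" by (rule graph_hypercube)
  {
    case 0
    then have "u = v" using assms by (simp add: hamming_eq_0_iff)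
    then show ?case
      using assms by (intro exI[of _ "[]"]) (simp add: awalk_Nil_iff hamming_eq_0_iff)
  next
    case (Suc h)
    then have "hamming u v \<noteq> 0" by simp
    then have "{i. i < length u \<and> u ! i \<noteq> v ! i} \<noteq> {}"
      unfolding hamming_def by (metis card.empty)
    then obtain i where i: "i < n" "u ! i \<noteq> v ! i" using Suc.prems by blast
    define u' where "u' = u[i := v ! i]"
    have "{j. j < n \<and> u ! j \<noteq> u' ! j} = {i}"
      using i Suc.prems by (auto simp: u'_def nth_list_update)
    then have arc: "(u, u') \<in> arcs (hypercube n)"
      using Suc.prems by (simp add: arcs_hypercube_iff hamming_def u'_def)
    have "{j. j < length u' \<and> u' ! j \<noteq> v ! j} = {j. j < length u \<and> u ! j \<noteq> v ! j} - {i}"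
      using i Suc.prems by (auto simp: u'_def nth_list_update)
    then have "hamming u' v = hamming u v - 1"
      using i Suc.prems by (simp add: hamming_def)
    with Suc.hyps(2) have h: "h = hamming u' v" by simp
    moreover have "length u' = n" using Suc.prems by (simp add: u'_def)
    ultimately obtain p where "awalk u' p v" "length p = h"
      using Suc.hyps(1) by metis
    then show ?case
      using arc Suc.hyps(2)
      by (intro exI[of _ "(u, u') # p"]) (simp add: awalk_Cons_iff)
  }
qed

lemma graph_dist_hypercube:
  assumes "length u = n" "length v = n"
  shows "graph_dist (hypercube n) u v = ereal (hamming u v)"
proof -
  interpret graph "hypercube n" by (rule graph_hypercube)
  have cost: "awalk_cost (\<lambda>_. 1) p = length p" for p :: "(bool list \<times> bool list) list"
    by (simp add: awalk_cost_def sum_list_triv)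
  obtain p where p: "awalk u p v" "length p = hamming u v"
    using ex_awalk_hypercube_hamming[OF assms] by blast
  show ?thesis
    unfolding graph_dist_def
  proof (rule antisym)
    show "\<mu> (\<lambda>_. 1) u v \<le> ereal (hamming u v)"
      using min_cost_le_walk_cost[OF p(1), of "\<lambda>_. 1"] p(2) by (simp add: cost)
    show "ereal (hamming u v) \<le> \<mu> (\<lambda>_. 1) u v"
      unfolding \<mu>_def by (intro INF_greatest) (simp add: cost awalk_hypercube_ge_hamming)
  qed
qed

text \<open>Both bounds are proved in this form, where walks and path costs no longer occur.\<close>

lemma multipacking_hypercube_iff:
  "multipacking (hypercube n) M \<longleftrightarrow> (\<forall>u\<in>M. length u = n) \<and>
    (\<forall>v k. length v = n \<longrightarrow> 1 \<le> k \<longrightarrow> card {u \<in> M. hamming v u \<le> k} \<le> k)"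
proof -
  have nbhd: "closed_nbhd (hypercube n) k v \<inter> M = {u \<in> M. hamming v u \<le> k}"
    if "\<forall>u\<in>M. length u = n" "length v = n" for k v
    using that by (auto simp: closed_nbhd_def graph_dist_hypercube)
  show ?thesis
  proof (cases "\<forall>u\<in>M. length u = n")
    case True
    then show ?thesis by (simp add: multipacking_def nbhd subset_iff)
  next
    case False
    then show ?thesis by (auto simp: multipacking_def)
  qed
qed

section \<open>The antipodal cycle and the lower bound\<close>

text \<open>
  An isometric cycle of length \<open>2 * n\<close> in which \<open>t\<close> and \<open>t + n\<close> are antipodal: for \<open>t \<le> n\<close> the first
  \<open>t\<close> coordinates are set, and for \<open>n \<le> t \<le> 2 * n\<close> the first \<open>t - n\<close> of them are cleared again.
\<close>

definition antipodal_cycle :: "nat \<Rightarrow> nat \<Rightarrow> bool list" where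
  "antipodal_cycle n t = map (\<lambda>i. i < t \<and> t \<le> i + n) [0..<n]"

lemma length_antipodal_cycle [simp]: "length (antipodal_cycle n t) = n"
  by (simp add: antipodal_cycle_def)

text \<open>This is isometry: the distance is the length of the shorter arc. Depending on the halves
  of the cycle that contain \<open>s\<close> and \<open>t\<close>, the differing coordinates form
  one interval or two disjoint ones.\<close>

lemma hamming_antipodal_cycle_le:
  assumes "s \<le> t" "t \<le> 2 * n"
  shows "hamming (antipodal_cycle n s) (antipodal_cycle n t) = min (t - s) (2 * n - (t - s))"
proof -
  let ?D = "{i. i < n \<and> (i < s \<and> s \<le> i + n) \<noteq> (i < t \<and> t \<le> i + n)}"
  have "hamming (antipodal_cycle n s) (antipodal_cycle n t) = card ?D"
    unfolding hamming_def by (rule arg_cong[where f = card]) (auto simp: antipodal_cycle_def)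
  also have "\<dots> = min (t - s) (2 * n - (t - s))"
  proof (cases "t \<le> n")
    case True
    then have "?D = {s..<t}" using assms by auto
    then show ?thesis using True assms by simp
  next
    case t: False
    show ?thesis
    proof (cases "n \<le> s")
      case True
      then have "?D = {s - n..<t - n}" using assms t by auto
      then show ?thesis using True assms t by simp
    next
      case False
      show ?thesis
      proof (cases "t - n \<le> s")
        case True
        have "?D = {..<t - n} \<union> {s..<n}" using assms t False True by auto
        moreover have "{..<t - n} \<inter> {s..<n} = {}" using True by auto
        ultimately have "card ?D = (t - n) + (n - s)" by (simp add: card_Un_disjoint)
        then show ?thesis using True False t assms by simp
      next
        case False': False
        have "?D = {..<s} \<union> {t - n..<n}" using assms t False False' by auto
        moreover have "{..<s} \<inter> {t - n..<n} = {}" using False' by auto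
        ultimately have "card ?D = s + (n - (t - n))" by (simp add: card_Un_disjoint)
        then show ?thesis using False False' t assms by simp
      qed
    qed
  qed
  finally show ?thesis .
qed

lemma hamming_antipodal_cycle:
  assumes "s \<le> 2 * n" "t \<le> 2 * n"
  shows "int (hamming (antipodal_cycle n s) (antipodal_cycle n t)) =
    min \<bar>int s - int t\<bar> (2 * int n - \<bar>int s - int t\<bar>)"
proof (cases "s \<le> t")
  case True
  then have "\<bar>int s - int t\<bar> = int t - int s" by simp
  then show ?thesis
    using hamming_antipodal_cycle_le[OF True assms(2)] True assms by simp
next
  case False
  then have "t \<le> s" "\<bar>int s - int t\<bar> = int s - int t" by simp_all
  then show ?thesis
    using hamming_antipodal_cycle_le[of t s n] assms
      hamming_commute[of "antipodal_cycle n s" "antipodal_cycle n t"] by simp linarith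
qed

text \<open>Pigeonhole: cut into blocks of length \<open>r\<close> from the minimum on, each block
  contains at most one point.\<close>

lemma card_separated_ints_le:
  fixes G :: "int set"
  assumes "finite G"
    and "\<And>x y. x \<in> G \<Longrightarrow> y \<in> G \<Longrightarrow> x \<noteq> y \<Longrightarrow> int r \<le> \<bar>x - y\<bar>"
    and "\<And>x y. x \<in> G \<Longrightarrow> y \<in> G \<Longrightarrow> \<bar>x - y\<bar> \<le> int d" and "r > 0"
  shows "card G \<le> d div r + 1"
proof (cases "G = {}")
  case False
  define a where "a = Min G"
  have a: "a \<in> G" "\<And>x. x \<in> G \<Longrightarrow> a \<le> x"
    using assms(1) False by (simp_all add: a_def)
  define h where "h x = (x - a) div int r" for x
  have "inj_on h G"
  proof (rule inj_onI, rule ccontr)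
    fix x y assume xy: "x \<in> G" "y \<in> G" "h x = h y" "x \<noteq> y"
    have "x - a = int r * h x + (x - a) mod int r" "y - a = int r * h y + (y - a) mod int r"
      by (simp_all add: h_def)
    then have "x - y = (x - a) mod int r - (y - a) mod int r"
      using xy(3) by simp
    moreover have "0 \<le> (x - a) mod int r" "(x - a) mod int r < int r"
      "0 \<le> (y - a) mod int r" "(y - a) mod int r < int r"
      using \<open>r > 0\<close> by simp_all
    ultimately have "\<bar>x - y\<bar> < int r" by linarith
    then show False using assms(2)[OF xy(1,2,4)] by simp
  qed
  moreover have "h ` G \<subseteq> {0..int d div int r}"
  proof (intro image_subsetI)
    fix x assume x: "x \<in> G"
    have "x - a \<le> int d" using assms(3)[OF x a(1)] by simp
    then show "h x \<in> {0..int d div int r}"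
      using a(2)[OF x] \<open>r > 0\<close> by (simp add: h_def zdiv_mono1 pos_imp_zdiv_nonneg_iff)
  qed
  ultimately have "card G \<le> card {0..int d div int r}"
    by (intro card_inj_on_le) simp_all
  also have "\<dots> = d div r + 1"
    by (simp flip: zdiv_int add: nat_add_distrib)
  finally show ?thesis .
qed simp

text \<open>Points in the ball are pairwise within \<open>2 * k\<close>. As
  \<open>4 * k < n\<close>, they lie on an arc shorter than half the cycle, where they behave like
  integers with gaps of at least 3.\<close>

lemma card_antipodal_cycle_ball_le:
  assumes T: "T \<subseteq> {..<2 * n}" and "length v = n" and k: "4 * k < n" "1 \<le> k"
    and sep: "\<And>s t. s \<in> T \<Longrightarrow> t \<in> T \<Longrightarrow> s \<noteq> t \<Longrightarrow> 3 \<le> hamming (antipodal_cycle n s) (antipodal_cycle n t)"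
    and ball: "\<And>t. t \<in> T \<Longrightarrow> hamming v (antipodal_cycle n t) \<le> k"
  shows "card T \<le> k"
proof (cases "T = {}")
  case False
  then obtain p where p: "p \<in> T" by blast
  \<comment> \<open>\<open>g\<close> unrolls the arc of the cycle within distance \<open>2 * k\<close> of \<open>p\<close> to an interval of integers.\<close>
  define g where "g t = (let d = int t - int p in
    if \<bar>d\<bar> \<le> 2 * int k then d else if d > 0 then d - 2 * int n else d + 2 * int n)" for t
  define dist where "dist s t = min \<bar>int s - int t\<bar> (2 * int n - \<bar>int s - int t\<bar>)" for s t
  have dist: "int (hamming (antipodal_cycle n s) (antipodal_cycle n t)) = dist s t" if "s \<in> T" "t \<in> T" for s t
    using hamming_antipodal_cycle[of s n t] that T by (force simp: dist_def)
  have bound: "dist s t \<le> 2 * int k" if "s \<in> T" "t \<in> T" for s t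
  proof -
    have "hamming (antipodal_cycle n s) (antipodal_cycle n t) \<le>
        hamming (antipodal_cycle n s) v + hamming v (antipodal_cycle n t)"
      using \<open>length v = n\<close> by (intro hamming_triangle) simp
    then have "hamming (antipodal_cycle n s) (antipodal_cycle n t) \<le> 2 * k"
      using ball[OF that(1)] ball[OF that(2)] hamming_commute[of v "antipodal_cycle n s"] \<open>length v = n\<close>
      by simp
    then show ?thesis using dist[OF that] by linarith
  qed
  \<comment> \<open>Both values of \<open>g\<close> lie between \<open>- 2 * k\<close> and
    \<open>2 * k\<close>, so they differ by less than \<open>n\<close> and the direct arc is the
    shorter one.\<close>
  have g_dist: "\<bar>g s - g t\<bar> = dist s t" if "s \<in> T" "t \<in> T" for s t
  proof -
    have "s < 2 * n" "t < 2 * n" "p < 2 * n" using T that p by auto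
    then show ?thesis
      using bound[OF that(1) p] bound[OF that(2) p] bound[OF that] k
      unfolding dist_def g_def Let_def by (simp split: if_splits add: min_def abs_if)
  qed
  have sep': "3 \<le> dist s t" if "s \<in> T" "t \<in> T" "s \<noteq> t" for s t
    using sep[OF that] dist[OF that(1,2)] by linarith
  have "inj_on g T"
    by (rule inj_onI, rule ccontr) (use g_dist sep' in fastforce)
  then have "card T = card (g ` T)"
    by (simp add: card_image)
  also have "\<dots> \<le> 2 * k div 3 + 1"
  proof (rule card_separated_ints_le)
    show "finite (g ` T)" using T finite_subset by blast
    show "int 3 \<le> \<bar>x - y\<bar>" if "x \<in> g ` T" "y \<in> g ` T" "x \<noteq> y" for x y
      using that g_dist sep' by fastforce
    show "\<bar>x - y\<bar> \<le> int (2 * k)" if "x \<in> g ` T" "y \<in> g ` T" for x y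
      using that g_dist bound by fastforce
  qed simp
  \<comment> \<open>Equality holds for \<open>k\<close> equal to 1, 2 and 3.\<close>
  also have "\<dots> \<le> k"
    using \<open>1 \<le> k\<close> by linarith
  finally show ?thesis .
qed simp

lemma ex_multipacking_hypercube: "\<exists>M. multipacking (hypercube n) M \<and> card M = n div 2"
proof -
  define m where "m = n div 2"
  \<comment> \<open>\<open>R\<close> antipodal pairs give \<open>m\<close> or \<open>m + 1\<close>
    points; for odd \<open>m\<close> the choice of \<open>U\<close> drops one.\<close>
  define R where "R = (m + 1) div 2"
  define T0 where "T0 = (\<lambda>j. 3 * j) ` {..<R}"
  define T where "T = T0 \<union> (\<lambda>t. n + t) ` T0"
  have R3: "3 * j < n" if "j < R" for j
    using that unfolding R_def m_def by linarith
  have T0n: "T0 \<subseteq> {..<n}" using R3 by (auto simp: T0_def)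
  have T2n: "T \<subseteq> {..<2 * n}" using T0n by (fastforce simp: T_def)
  have cardT0: "card T0 = R" by (simp add: T0_def card_image inj_on_def)
  have "finite T0" by (simp add: T0_def)
  then have "card T = 2 * R"
    unfolding T_def using T0n by (subst card_Un_disjoint) (auto simp: card_image cardT0)
  then have "m \<le> card T" by (simp add: R_def)
  then obtain U where U: "U \<subseteq> T" "card U = m" "finite U"
    by (meson obtain_subset_with_card_n)
  define M where "M = antipodal_cycle n ` U"
  have dist: "int (hamming (antipodal_cycle n s) (antipodal_cycle n t)) =
      min \<bar>int s - int t\<bar> (2 * int n - \<bar>int s - int t\<bar>)" if "s \<in> T" "t \<in> T" for s t
    using that T2n by (intro hamming_antipodal_cycle) force+
  have inj: "inj_on (antipodal_cycle n) T"
  proof (rule inj_onI)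
    fix s t assume st: "s \<in> T" "t \<in> T" "antipodal_cycle n s = antipodal_cycle n t"
    then have "hamming (antipodal_cycle n s) (antipodal_cycle n t) = 0"
      by (simp add: hamming_eq_0_iff)
    moreover have "s < 2 * n" "t < 2 * n" using st T2n by auto
    ultimately show "s = t" using dist[OF st(1,2)] by (simp add: min_def split: if_splits)
  qed
  have "card M = m"
    using U inj inj_on_subset by (force simp: M_def card_image)
  moreover have "card {u \<in> M. hamming v u \<le> k} \<le> k" if v: "length v = n" and "1 \<le> k" for v k
  proof -
    define B where "B = {t \<in> U. hamming v (antipodal_cycle n t) \<le> k}"
    have B: "B \<subseteq> T" "finite B" "card B \<le> m"
      using U card_mono[of U B] by (auto simp: B_def)
    have "{u \<in> M. hamming v u \<le> k} = antipodal_cycle n ` B"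
      by (auto simp: B_def M_def)
    then have "card {u \<in> M. hamming v u \<le> k} \<le> card B"
      using B by (simp add: card_image_le)
    also have "card B \<le> k"
    proof (cases "k < m")
      case False
      then show ?thesis using B by simp
    next
      case km: True
      show ?thesis
      proof (cases "k < R")
        case True
        \<comment> \<open>\<open>3 * R \<le> n\<close> can fail for small \<open>n\<close>, for
          instance 2, but \<open>1 \<le> k < R\<close> gives \<open>R \<ge> 2\<close>. It keeps
          points of different halves at least 3 apart.\<close>
        have R: "3 * R \<le> n" "3 \<le> n" "4 * k < n"
          using True \<open>1 \<le> k\<close> unfolding R_def m_def by linarith+
        have "3 \<le> hamming (antipodal_cycle n s) (antipodal_cycle n t)"
          if st: "s \<in> T" "t \<in> T" "s \<noteq> t" for s t
        proof -
          have "\<exists>i<R. s = 3 * i \<or> s = n + 3 * i" "\<exists>j<R. t = 3 * j \<or> t = n + 3 * j"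
            using st by (auto simp: T_def T0_def)
          then obtain i j where "i < R" "j < R" "s = 3 * i \<or> s = n + 3 * i" "t = 3 * j \<or> t = n + 3 * j"
            by blast
          then have "3 \<le> \<bar>int s - int t\<bar>" "3 \<le> 2 * int n - \<bar>int s - int t\<bar>"
            using R st(3) by auto
          then show ?thesis using dist[OF st(1,2)] by linarith
        qed
        then show ?thesis
          using B T2n v R \<open>1 \<le> k\<close> by (intro card_antipodal_cycle_ball_le[of B n v]) (auto simp: B_def)
      next
        case False
        \<comment> \<open>Reduction modulo \<open>n\<close> identifies antipodal points. These are
          \<open>n\<close> apart, whereas points of the ball are at most \<open>2 * k < n\<close>
          apart, so each pair contributes at most one.\<close>
        have "inj_on (\<lambda>t. t mod n) B"
        proof (rule inj_onI, rule ccontr)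
          fix s t assume st: "s \<in> B" "t \<in> B" "s mod n = t mod n" "s \<noteq> t"
          have "s < 2 * n" "t < 2 * n" using st B T2n by auto
          then have "\<bar>int s - int t\<bar> = int n"
            using st(3,4) by (auto simp: mod_if split: if_splits)
          then have "hamming (antipodal_cycle n s) (antipodal_cycle n t) = n"
            using dist[of s t] st B by auto
          moreover have "hamming (antipodal_cycle n s) (antipodal_cycle n t) \<le>
              hamming (antipodal_cycle n s) v + hamming v (antipodal_cycle n t)"
            using v by (intro hamming_triangle) simp
          moreover have "hamming (antipodal_cycle n s) v \<le> k" "hamming v (antipodal_cycle n t) \<le> k"
            using st hamming_commute[of v "antipodal_cycle n s"] v by (auto simp: B_def)
          ultimately show False using km by (simp add: m_def)
        qed
        moreover have "(\<lambda>t. t mod n) ` B \<subseteq> T0"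
        proof (intro image_subsetI)
          fix t assume "t \<in> B"
          then consider "t \<in> T0" | u where "t = n + u" "u \<in> T0"
            using B(1) by (auto simp: T_def)
          moreover have "u mod n = u" if "u \<in> T0" for u
            using T0n that by auto
          ultimately show "t mod n \<in> T0"
            by cases simp_all
        qed
        ultimately have "card B \<le> card T0"
          using \<open>finite T0\<close> by (rule card_inj_on_le)
        then show ?thesis using False by (simp add: cardT0)
      qed
    qed
    finally show ?thesis .
  qed
  moreover have "\<forall>u\<in>M. length u = n"
    by (auto simp: M_def)
  ultimately show ?thesis
    unfolding multipacking_hypercube_iff m_def by blast
qed

section \<open>The upper bound from discrepancy\<close>

lemma multipacking_hypercube_card_le:
  assumes M: "multipacking (hypercube n) M" and n: "n \<ge> 1"
  shows "real (card M) \<le> real n / 2 + 6 * sqrt (2 * real n)"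
proof -
  have len: "\<And>u. u \<in> M \<Longrightarrow> length u = n"
    and ball: "\<And>v k. length v = n \<Longrightarrow> 1 \<le> k \<Longrightarrow> card {u \<in> M. hamming v u \<le> k} \<le> k"
    using M by (simp_all add: multipacking_hypercube_iff)
  have "finite M"
    using len finite_lists_length_eq[of "UNIV :: bool set" n]
    by (intro finite_subset[of M "{u. length u = n}"]) auto
  have "card {u \<in> M. hamming (replicate n False) u \<le> n} \<le> n"
    using n by (intro ball) simp_all
  moreover have "{u \<in> M. hamming (replicate n False) u \<le> n} = M"
    using hamming_le_length[of "replicate n False"] by auto
  ultimately have card_M: "card M \<le> card {..<n}" by simp
  define c :: "bool list \<Rightarrow> nat \<Rightarrow> real" where "c u j = (if u ! j then 1 else - 1)" for u j
  have "\<bar>c u j\<bar> \<le> 1" for u j by (simp add: c_def)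
  then obtain x where x: "\<And>j. j < n \<Longrightarrow> \<bar>x j\<bar> = 1"
      "\<And>u. u \<in> M \<Longrightarrow> \<bar>\<Sum>j<n. c u j * x j\<bar> \<le> 12 * sqrt 2 * sqrt n"
    using spencer_discrepancy[OF \<open>finite M\<close> finite_lessThan card_M, of c]
    unfolding card_lessThan by blast
  define v where "v = map (\<lambda>j. x j = 1) [0..<n]"
  define r where "r = real n / 2 + 6 * sqrt (2 * real n)"
  \<comment> \<open>Rounding \<open>r\<close> down loses nothing, as Hamming distances are
    integers.\<close>
  define k where "k = nat \<lfloor>r\<rfloor>"
  have "1 \<le> sqrt (2 * real n)" using n by simp
  then have r: "1 \<le> r" unfolding r_def using n by linarith
  then have k: "1 \<le> k" "real k \<le> r" by (simp_all add: k_def le_nat_iff le_floor_iff)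
  have "hamming v u \<le> k" if u: "u \<in> M" for u
  proof -
    \<comment> \<open>Agreeing signs contribute 1 and differing ones -1, so the inner product is
      \<open>n - 2 * hamming v u\<close>; this halves the constant 12 to 6.\<close>
    have "c u j * x j = 1 - 2 * of_bool (v ! j \<noteq> u ! j)" if "j < n" for j
      using x(1)[OF that] that by (auto simp: c_def v_def abs_if split: if_splits)
    then have "(\<Sum>j<n. c u j * x j) = (\<Sum>j<n. 1 - 2 * of_bool (v ! j \<noteq> u ! j))"
      by simp
    also have "\<dots> = real n - 2 * (\<Sum>j<n. of_bool (v ! j \<noteq> u ! j))"
      by (simp add: sum_subtractf flip: sum_distrib_left)
    also have "(\<Sum>j<n. of_bool (v ! j \<noteq> u ! j)) = real (card ({..<n} \<inter> {j. v ! j \<noteq> u ! j}))"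
      by simp
    also have "{..<n} \<inter> {j. v ! j \<noteq> u ! j} = {j. j < length v \<and> v ! j \<noteq> u ! j}"
      by (auto simp: v_def)
    also have "card \<dots> = hamming v u"
      by (simp add: hamming_def)
    finally have "real (hamming v u) \<le> real n / 2 + 6 * (sqrt 2 * sqrt n)"
      using x(2)[OF u] by linarith
    then have "real (hamming v u) \<le> r" by (simp add: r_def real_sqrt_mult)
    then show ?thesis using r by (simp add: k_def le_nat_iff le_floor_iff)
  qed
  then have "{u \<in> M. hamming v u \<le> k} = M" by blast
  then have "card M \<le> k" using ball[of v k] k by (simp add: v_def)
  then show ?thesis using k by (simp add: r_def)
qed

theorem theorem1:
  fixes n :: nat
  assumes "n \<ge> 1"
  shows "\<lfloor>real n / 2\<rfloor> \<le> int (mp (hypercube n)) \<and>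
         real (mp (hypercube n)) \<le> real n / 2 + 6 * sqrt (2 * real n)"
proof
  have fin: "finite {card M | M. multipacking (hypercube n) M}"
    using finite_lists_length_eq[of "UNIV :: bool set" n] by (intro finite_multipackings) simp
  obtain M where M: "multipacking (hypercube n) M" "card M = n div 2"
    using ex_multipacking_hypercube by blast
  have "card M \<le> mp (hypercube n)"
    unfolding mp_def using M(1) by (intro Max_ge[OF fin]) blast
  moreover have "\<lfloor>real n / 2\<rfloor> = int (n div 2)"
    using floor_divide_of_nat_eq[of n 2] by simp
  ultimately show "\<lfloor>real n / 2\<rfloor> \<le> int (mp (hypercube n))"
    using M(2) by simp
  have "mp (hypercube n) \<in> {card M | M. multipacking (hypercube n) M}"
    unfolding mp_def using fin multipacking_empty by (intro Max_in) blast+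
  then obtain M' where "multipacking (hypercube n) M'" "mp (hypercube n) = card M'"
    by blast
  then show "real (mp (hypercube n)) \<le> real n / 2 + 6 * sqrt (2 * real n)"
    using multipacking_hypercube_card_le assms by simp
qed

end
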